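(* Let $ABC$ be a triangle inscribed in a circle $\Gamma$, and let $D_4$ be a point, distinct from $A,B,C$ and from the orthocentre of $ABC$. Let $\mathcal{C}$ be a central conic (an ellipse or a hyperbola), with centre $M$, passing through $A, B, C, D_4$ and such that the image $D$ of $D_4$ under the $180^\circ$ rotation about $M$ lies on $\Gamma$ and is distinct from $A,B,C$. Let $A_1, B_2, C_3$ be the images of $A, B, C$ respectively under the $180^\circ$ rotation about $M$. Let $P$ be a point of $\mathcal{C}$, not on $\Gamma$ or on the side lines of $ABC$, and distinct from $A_1,B_2,C_3,D_4$. Define $$A_4=A_1P\cap AD_4,\quad B_4=B_2P\cap BD_4,\quad C_4=C_3P\cap CD_4,$$ $$B_1=B_2P\cap BA_1,\quad C_1=C_3P\cap CA_1,\quad D_1=D_4P\cap DA_1,$$ $$A_2=A_1P\cap AB_2,\quad C_2=C_3P\cap CB_2,\quad D_2=D_4P\cap DB_2,$$ $$A_3=A_1P\cap AC_3,\quad B_3=B_2P\cap BC_3,\quad D_3=D_4P\cap DC_3,$$ and let $\Sigma_4$, $\Sigma_1$, $\Sigma_2$, $\Sigma_3$ be the circles $A_4B_4C_4$, $B_1C_1D_1$, $A_2C_2D_2$, $A_3B_3D_3$ respectively. Then $\Sigma_4$ passes through $D_4$, and similarly $\Sigma_1, \Sigma_2, \Sigma_3$ pass through $A_1, B_2, C_3$ respectively.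
   Context: All objects lie in the Euclidean plane. For distinct points $R,S$, $RS$ denotes the line through them, and for non-collinear points $R,S,T$, circle $RST$ is the circle through them. Conics are non-degenerate. The configuration is assumed non-degenerate: each line named joins two distinct points, each pair of lines named meets in exactly one point, and the triples of points defining $\Sigma_1,\Sigma_2,\Sigma_3,\Sigma_4$ are not collinear. *)

theory Defs
  imports "HOL-Analysis.Analysis"
begin

type_synonym point = "real^2"

definition line_through :: "point \<Rightarrow> point \<Rightarrow> point set" where
  "line_through R S = affine hull {R, S}"

text \<open>The intersection is required to be exactly a singleton, so the two lines are neither
  parallel nor equal.\<close>

definition meet_at :: "point \<Rightarrow> point \<Rightarrow> point \<Rightarrow> point \<Rightarrow> point \<Rightarrow> bool" where
  "meet_at R S T U X \<longleftrightarrow>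
     R \<noteq> S \<and> T \<noteq> U \<and> line_through R S \<inter> line_through T U = {X}"

definition is_circle :: "point set \<Rightarrow> bool" where
  "is_circle K \<longleftrightarrow> (\<exists>c r. r > 0 \<and> K = sphere c r)"

text \<open>For non-collinear points exactly one such \<open>K\<close> exists.\<close>

definition circle_through :: "point \<Rightarrow> point \<Rightarrow> point \<Rightarrow> point set \<Rightarrow> bool" where
  "circle_through R S T K \<longleftrightarrow> \<not> collinear {R, S, T} \<and> is_circle K \<and> {R, S, T} \<subseteq> K"

definition half_turn :: "point \<Rightarrow> point \<Rightarrow> point" where
  "half_turn M X = 2 *\<^sub>R M - X"

definition is_orthocentre :: "point \<Rightarrow> point \<Rightarrow> point \<Rightarrow> point \<Rightarrow> bool" where
  "is_orthocentre A B C H \<longleftrightarrow>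
     orthogonal (H - A) (B - C) \<and> orthogonal (H - B) (C - A) \<and> orthogonal (H - C) (A - B)"

text \<open>Ellipses (circles included) and hyperbolas with centre \<open>M\<close>, by their canonical equations
  in an orthonormal frame \<open>u, v\<close> at \<open>M\<close> along the axes. They are automatically non-degenerate.\<close>

definition is_ellipse :: "point set \<Rightarrow> point \<Rightarrow> bool" where
  "is_ellipse K M \<longleftrightarrow>
     (\<exists>u v a b. norm u = 1 \<and> norm v = 1 \<and> orthogonal u v \<and> a > 0 \<and> b > 0 \<and>
        K = {X. ((X - M) \<bullet> u)\<^sup>2 / a\<^sup>2 + ((X - M) \<bullet> v)\<^sup>2 / b\<^sup>2 = 1})"

definition is_hyperbola :: "point set \<Rightarrow> point \<Rightarrow> bool" where
  "is_hyperbola K M \<longleftrightarrow>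
     (\<exists>u v a b. norm u = 1 \<and> norm v = 1 \<and> orthogonal u v \<and> a > 0 \<and> b > 0 \<and>
        K = {X. ((X - M) \<bullet> u)\<^sup>2 / a\<^sup>2 - ((X - M) \<bullet> v)\<^sup>2 / b\<^sup>2 = 1})"

definition central_conic :: "point set \<Rightarrow> point \<Rightarrow> bool" where
  "central_conic K M \<longleftrightarrow> is_ellipse K M \<or> is_hyperbola K M"

end

theory Submission
  imports Defs
begin

text \<open>
  Take the centre \<open>M\<close> as origin and the axes of the conic as coordinate axes, so that the conic
  is \<open>p x\<^sup>2 + q y\<^sup>2 = 1\<close>, where \<open>p\<close>, \<open>q\<close> are positive or of opposite signs. A half turn is then
  \<open>X \<mapsto> - X\<close>, and since the conic is symmetric about its centre, \<open>D = - D\<^sub>4\<close> lies on it too. Thus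
  \<open>A\<close>, \<open>B\<close>, \<open>C\<close>, \<open>D\<close> are four points common to the conic and to \<open>\<Gamma>\<close>, and the whole configuration is
  symmetric in them: each of the four circles belongs to one of the points, say \<open>D\<close>, and passes
  through the points where the line joining \<open>- X\<close> to \<open>P\<close> meets the line joining \<open>X\<close> to \<open>- D\<close>, for
  \<open>X\<close> among the other three. The four claims are one claim, that this circle passes through \<open>- D\<close>.

  Write \<open>\<kappa>\<close> for the bilinear form of the conic and \<open>\<omega>\<close> for the determinant of two vectors. The point
  on the line through \<open>A\<close> is \<open>- D + t (A + D)\<close>, where
  \<open>t (1 + \<kappa>(A, D)) (1 - \<kappa>(D, P)) = p q \<omega>(D, P) \<omega>(D, A)\<close>. A circle through \<open>- D\<close> has an equation
  \<open>|W + D|\<^sup>2 = h \<bullet> (W + D)\<close>, so it is enough to find one vector \<open>h\<close> with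
  \<open>t |A + D|\<^sup>2 = h \<bullet> (A + D)\<close> and likewise with \<open>B\<close> and \<open>C\<close> in place of \<open>A\<close>. Up to a factor that
  depends only on the conic, \<open>D\<close> and \<open>P\<close>, such an \<open>h\<close> is given by \<open>h \<bullet> W = \<omega>(L, W)\<close> with
  \<open>L = 2 (p + q) D + (q - p) (A' + B' + C' - D')\<close>, where the prime is the reflection
  \<open>(x, y) \<mapsto> (x, - y)\<close>; note that \<open>L\<close> is symmetric in \<open>A\<close>, \<open>B\<close>, \<open>C\<close>.

  To see where \<open>L\<close> comes from, let the conic be an ellipse, not a circle, and let
  \<open>\<alpha>\<close>, \<open>\<beta>\<close>, \<open>\<gamma>\<close>, \<open>\<delta>\<close> be the eccentric angles of the four points. They are concyclic exactly if the angles add up to a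
  multiple of \<open>2 \<pi>\<close>. After cancellation, the condition is that \<open>2 sin(\<theta> - \<delta>) |e(\<theta>)|\<^sup>2\<close>, where \<open>e(\<theta>)\<close>
  is the point of the ellipse with angle \<open>\<theta>\<close>, agrees with a linear function of \<open>e(\<theta>)\<close> at the three
  angles \<open>\<theta> = (\<alpha> + \<delta>)/2\<close>, \<open>(\<beta> + \<delta>)/2\<close>, \<open>(\<gamma> + \<delta>)/2\<close>. Its only non-linear term is a multiple of
  \<open>sin(3 \<theta> - \<delta>)\<close>, and because of the angle sum this equals
  \<open>sin(\<theta> + \<alpha>) + sin(\<theta> + \<beta>) + sin(\<theta> + \<gamma>)\<close> there: for \<open>\<theta> = (\<alpha> + \<delta>)/2\<close> the first summand is
  \<open>sin(3 \<theta> - \<delta>)\<close> and the other two cancel. Up to a constant these sines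
  are the determinants of \<open>A'\<close>, \<open>B'\<close>, \<open>C'\<close> with \<open>e(\<theta>)\<close>.

  The cancellation says that \<open>A + D\<close> is parallel to the reflection of \<open>B + C\<close>, which is the classical
  fact that opposite chords of four concyclic points of a conic are equally inclined to its axes
  (\<open>concyclic_chords_antiparallel\<close>). Through it concyclicity enters the formula for \<open>h\<close>. The
  formulas for \<open>t\<close> and \<open>h\<close> become the polynomial identities \<open>chord_meeting_ratio\<close> and
  \<open>chord_length_identity\<close>, which hold for ellipses and hyperbolas alike.
\<close>

section \<open>Polynomial identities on a central conic\<close>

text \<open>
  With \<open>\<omega>\<close> the determinant of two vectors, collinearity of \<open>- A\<close>, \<open>P\<close> and \<open>- D + t (A + D)\<close> means
  \<open>t \<omega>(A + D, P + A) = \<omega>(D - A, P + A)\<close>. The identity replaces this ratio by one in which the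
  dependence on \<open>P\<close> is a factor common to all \<open>A\<close>. For an ellipse it reads
  \<open>t = tan((\<alpha> - \<delta>)/2) cot((\<phi> - \<delta>)/2)\<close> in terms of the eccentric angles \<open>\<alpha>\<close>, \<open>\<delta>\<close>, \<open>\<phi>\<close> of
  \<open>A\<close>, \<open>D\<close>, \<open>P\<close>.
\<close>

lemma chord_meeting_ratio:
  fixes p q :: real
  assumes "p * xA\<^sup>2 + q * yA\<^sup>2 = 1" "p * xD\<^sup>2 + q * yD\<^sup>2 = 1" "p * xP\<^sup>2 + q * yP\<^sup>2 = 1"
  shows "((xD - xA) * (yP + yA) - (yD - yA) * (xP + xA))
           * (1 + (p * xA * xD + q * yA * yD)) * (1 - (p * xD * xP + q * yD * yP))
       = p * q * (xD * yP - yD * xP) * (xD * yA - yD * xA)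
           * ((xA + xD) * (yP + yA) - (yA + yD) * (xP + xA))"
  using assms by algebra

text \<open>
  The square \<open>|X|\<^sup>2\<close> is a linear combination of \<open>p x\<^sup>2 + q y\<^sup>2\<close> and \<open>x\<^sup>2\<close>; the former contributes
  a multiple of \<open>D\<close>, the latter the reflected points and a further multiple of \<open>D\<close>. The
  last hypothesis makes the terms in \<open>B\<close> and \<open>C\<close> cancel; they are there so that the vector on the right-hand side does not change when \<open>A\<close>, \<open>B\<close>
  and \<open>C\<close> are permuted.
\<close>

lemma chord_length_identity:
  fixes p q :: real
  assumes "p * xA\<^sup>2 + q * yA\<^sup>2 = 1" "p * xD\<^sup>2 + q * yD\<^sup>2 = 1"
    and "(q - p) * ((xA + xD) * (yB + yC) + (yA + yD) * (xB + xC)) = 0"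
  shows "2 * p * q * (xD * yA - yD * xA) * ((xA + xD)\<^sup>2 + (yA + yD)\<^sup>2)
       = (1 + (p * xA * xD + q * yA * yD))
           * ((2 * (p + q) * xD + (q - p) * (xA + xB + xC - xD)) * (yA + yD)
            - (2 * (p + q) * yD - (q - p) * (yA + yB + yC - yD)) * (xA + xD))"
  using assms by algebra

text \<open>
  The tangent at a point of the conic meets it nowhere else. The reason is
  \<open>\<kappa>(A, A) \<kappa>(D, D) - \<kappa>(A, D)\<^sup>2 = p q \<omega>(A, D)\<^sup>2\<close>, where \<open>\<kappa>\<close> is the bilinear
  form of the conic and \<open>\<omega>\<close> the determinant; so \<open>\<kappa>(A, D) = 1\<close> makes \<open>A\<close> and \<open>D\<close> proportional. Applied to
  \<open>A\<close> and \<open>- D\<close>, and to \<open>D\<close> and \<open>P\<close>, it shows that the factors to be cancelled are not zero.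
\<close>

lemma conic_polar_eq_one:
  fixes p q :: real
  assumes "p * xA\<^sup>2 + q * yA\<^sup>2 = 1" "p * xD\<^sup>2 + q * yD\<^sup>2 = 1"
    and "p * xA * xD + q * yA * yD = 1" "p \<noteq> 0" "q \<noteq> 0"
  shows "xA = xD \<and> yA = yD"
proof -
  have "p * q * (xA * yD - yA * xD)\<^sup>2 = 0" using assms(1-3) by algebra
  hence *: "xA * yD - yA * xD = 0" using assms by simp
  have "xA = xD" "yA = yD" using * assms(1-3) by algebra+
  then show ?thesis ..
qed

section \<open>Coordinates in an orthonormal frame\<close>

lemma parallel_imp_multiple:
  fixes a b x y :: real
  assumes "x * b = y * a" and ne: "a \<noteq> 0 \<or> b \<noteq> 0"
  obtains l where "x = l * a" "y = l * b"
proof (cases "a = 0")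
  case True
  then show thesis using assms by (intro that[of "y / b"]) auto
next
  case False
  then show thesis using assms(1) by (intro that[of "x / a"]) (auto simp: field_simps)
qed

locale orthonormal_frame =
  fixes u v M :: point
  assumes norm_u: "norm u = 1" and norm_v: "norm v = 1" and orth: "orthogonal u v"
begin

definition xc :: "point \<Rightarrow> real" where "xc X = (X - M) \<bullet> u"
definition yc :: "point \<Rightarrow> real" where "yc X = (X - M) \<bullet> v"

lemma frame_inner [simp]: "u \<bullet> u = 1" "v \<bullet> v = 1" "u \<bullet> v = 0" "v \<bullet> u = 0"
  using norm_u norm_v orth
  by (auto simp: orthogonal_def inner_commute norm_eq_1)

lemma norm_square_frame: "(norm z)\<^sup>2 = (z \<bullet> u)\<^sup>2 + (z \<bullet> v)\<^sup>2"
proof -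
  have 1: "u$1 * u$1 + u$2 * u$2 = 1" "v$1 * v$1 + v$2 * v$2 = 1" "u$1 * v$1 + u$2 * v$2 = 0"
    using frame_inner by (simp_all add: inner_vec_def sum_2)
  have 2: "u$1 * u$1 + v$1 * v$1 = 1" "u$2 * u$2 + v$2 * v$2 = 1" "u$1 * u$2 + v$1 * v$2 = 0"
    using 1 by algebra+
  have "(z$1 * u$1 + z$2 * u$2)\<^sup>2 + (z$1 * v$1 + z$2 * v$2)\<^sup>2 = z$1 * z$1 + z$2 * z$2"
    using 2 by algebra
  then show ?thesis
    by (simp add: power2_norm_eq_inner inner_vec_def sum_2)
qed

lemma frame_eqI: "z \<bullet> u = w \<bullet> u \<Longrightarrow> z \<bullet> v = w \<bullet> v \<Longrightarrow> z = w" for z w :: point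
  using norm_square_frame[of "z - w"] by (simp add: inner_diff_left)

lemma coords_eqI: "xc X = xc Y \<Longrightarrow> yc X = yc Y \<Longrightarrow> X = Y"
  using frame_eqI[of "X - M" "Y - M"] by (simp add: xc_def yc_def)

lemma coords_half_turn [simp]:
  "xc (half_turn M X) = - xc X" "yc (half_turn M X) = - yc X"
  by (simp_all add: xc_def yc_def half_turn_def inner_diff_left)

lemma coords_line:
  "xc (R + t *\<^sub>R (S - R)) = xc R + t * (xc S - xc R)"
  "yc (R + t *\<^sub>R (S - R)) = yc R + t * (yc S - yc R)"
  by (simp_all add: xc_def yc_def inner_diff_left inner_add_left algebra_simps)

text \<open>
  In this form the equations of two circles differ by an affine function, and on a circle
  \<open>x\<^sup>2 + y\<^sup>2\<close> agrees with one.
\<close>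

lemma circle_equation:
  assumes "is_circle K"
  obtains g h k where "K = {X. (xc X)\<^sup>2 + (yc X)\<^sup>2 = g * xc X + h * yc X + k}"
proof -
  obtain c r where r: "r > 0" and K: "K = sphere c r"
    using assms by (auto simp: is_circle_def)
  have "X \<in> K \<longleftrightarrow> (xc X)\<^sup>2 + (yc X)\<^sup>2
      = (2 * xc c) * xc X + (2 * yc c) * yc X + (r\<^sup>2 - (xc c)\<^sup>2 - (yc c)\<^sup>2)" for X
  proof -
    have "X \<in> K \<longleftrightarrow> (norm (X - c))\<^sup>2 = r\<^sup>2"
      using r by (simp add: K dist_norm norm_minus_commute)
    also have "(norm (X - c))\<^sup>2 = (xc X - xc c)\<^sup>2 + (yc X - yc c)\<^sup>2"
      by (simp add: norm_square_frame xc_def yc_def inner_diff_left)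
    finally show ?thesis by (auto simp: power2_eq_square algebra_simps)
  qed
  then show thesis by (intro that) blast
qed

text \<open>
  The last conclusion, that the lines are not parallel, is what uniqueness of the common point
  amounts to: if the directions were proportional, moving the common point along one line would
  keep it on the other.
\<close>

lemma meet_at_coords:
  assumes "meet_at R S T U X"
  obtains t where "xc X = xc U + t * (xc T - xc U)" "yc X = yc U + t * (yc T - yc U)"
    and "(xc X - xc R) * (yc S - yc R) = (yc X - yc R) * (xc S - xc R)"
    and "(xc T - xc U) * (yc S - yc R) \<noteq> (yc T - yc U) * (xc S - xc R)"
proof -
  have RS: "R \<noteq> S" and TU: "T \<noteq> U"
    and only: "line_through R S \<inter> line_through U T = {X}"
    using assms by (auto simp: meet_at_def line_through_def insert_commute)
  have line: "line_through R S = range (\<lambda>s. R + s *\<^sub>R (S - R))" for R S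
    by (simp add: line_through_def affine_hull_2_alt)
  obtain s where s: "X = R + s *\<^sub>R (S - R)" using only line by blast
  obtain t where t: "X = U + t *\<^sub>R (T - U)" using only line by blast
  have "(xc T - xc U) * (yc S - yc R) \<noteq> (yc T - yc U) * (xc S - xc R)"
  proof
    assume par: "(xc T - xc U) * (yc S - yc R) = (yc T - yc U) * (xc S - xc R)"
    define a b where "a = xc S - xc R" and "b = yc S - yc R"
    have "a \<noteq> 0 \<or> b \<noteq> 0" using RS coords_eqI[of S R] by (auto simp: a_def b_def)
    then obtain l where "xc T - xc U = l * a" "yc T - yc U = l * b"
      by (rule parallel_imp_multiple[OF par[folded a_def b_def]])
    hence "T - U = l *\<^sub>R (S - R)"
      by (intro frame_eqI) (simp_all add: a_def b_def xc_def yc_def inner_diff_left)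
    hence "X + (T - U) = R + (s + l) *\<^sub>R (S - R)"
      by (simp add: s scaleR_add_left)
    moreover have "X + (T - U) = U + (t + 1) *\<^sub>R (T - U)"
      by (simp add: t scaleR_add_left)
    ultimately have "X + (T - U) \<in> line_through R S \<inter> line_through U T"
      unfolding line by blast
    with only TU show False by simp
  qed
  moreover have "(xc X - xc R) * (yc S - yc R) = (yc X - yc R) * (xc S - xc R)"
    by (simp add: s coords_line)
  ultimately show thesis using that t coords_line by metis
qed

lemma three_points_on_circle_not_aligned:
  assumes K: "is_circle K" and in_K: "A \<in> K" "D \<in> K" "B \<in> K"
    and ne: "A \<noteq> D" "B \<noteq> A" "B \<noteq> D"
  shows "(xc D - xc A) * (yc B - yc A) - (yc D - yc A) * (xc B - xc A) \<noteq> 0"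
proof
  assume par: "(xc D - xc A) * (yc B - yc A) - (yc D - yc A) * (xc B - xc A) = 0"
  obtain g h k where eq: "K = {X. (xc X)\<^sup>2 + (yc X)\<^sup>2 = g * xc X + h * yc X + k}"
    using circle_equation[OF K] .
  define a b where "a = xc D - xc A" and "b = yc D - yc A"
  have n: "a \<noteq> 0 \<or> b \<noteq> 0" using ne(1) coords_eqI[of D A] by (auto simp: a_def b_def)
  have "(xc B - xc A) * b = (yc B - yc A) * a"
    using par by (simp add: a_def b_def mult.commute)
  then obtain l where "xc B - xc A = l * a" "yc B - yc A = l * b"
    using n by (rule parallel_imp_multiple)
  hence l: "xc B = xc A + l * a" "yc B = yc A + l * b" by linarith+
  have D: "xc D = xc A + a" "yc D = yc A + b" by (simp_all add: a_def b_def)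
  \<comment> \<open>On the line the equation of the circle is quadratic in the parameter, with roots 0 at \<open>A\<close> and 1 at \<open>D\<close>.\<close>
  have "l * (l - 1) * (a\<^sup>2 + b\<^sup>2) = 0"
    using in_K unfolding eq mem_Collect_eq l D by algebra
  hence "l = 0 \<or> l = 1" using n by (auto simp: sum_power2_eq_zero_iff)
  with l D ne(2,3) coords_eqI[of B A] coords_eqI[of B D] show False by auto
qed

section \<open>Opposite chords of four concyclic points of a conic\<close>

definition affine_on :: "point set \<Rightarrow> (point \<Rightarrow> real) \<Rightarrow> bool" where
  "affine_on S F \<longleftrightarrow> (\<exists>a b c. \<forall>X\<in>S. F X = a * xc X + b * yc X + c)"

lemma affine_onI: "(\<And>X. X \<in> S \<Longrightarrow> F X = a * xc X + b * yc X + c) \<Longrightarrow> affine_on S F"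
  unfolding affine_on_def by blast

text \<open>
  Functions that are affine on \<open>S\<close> form a vector space; in this form the lemma lets a function be
  read off from a relation between it and functions already known to be affine on \<open>S\<close>.
\<close>

lemma affine_on_solve:
  assumes "affine_on S F" "affine_on S G" "c \<noteq> 0"
    and eq: "\<And>X. X \<in> S \<Longrightarrow> c * H X = f * F X + g * G X + a * xc X + b * yc X + e"
  shows "affine_on S H"
proof -
  obtain a1 b1 c1 where F: "\<And>X. X \<in> S \<Longrightarrow> F X = a1 * xc X + b1 * yc X + c1"
    using assms(1) unfolding affine_on_def by blast
  obtain a2 b2 c2 where G: "\<And>X. X \<in> S \<Longrightarrow> G X = a2 * xc X + b2 * yc X + c2"
    using assms(2) unfolding affine_on_def by blast
  show ?thesis
  proof (rule affine_onI)
    fix X assume X: "X \<in> S"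
    have "c * H X = (f * a1 + g * a2 + a) * xc X + (f * b1 + g * b2 + b) * yc X + (f * c1 + g * c2 + e)"
      using eq[OF X] F[OF X] G[OF X] by (simp add: algebra_simps)
    then show "H X = ((f * a1 + g * a2 + a) / c) * xc X + ((f * b1 + g * b2 + b) / c) * yc X
        + (f * c1 + g * c2 + e) / c"
      using assms(3) by (simp add: field_simps)
  qed
qed

text \<open>
  An affine function that vanishes at \<open>A\<close> and \<open>D\<close> is a constant multiple of the equation of the line
  through them, so off that line \<open>f\<close> is this constant.
\<close>

lemma affine_multiple_of_line:
  assumes aff: "affine_on S (\<lambda>X. f X * ((xc D - xc A) * (yc X - yc A) - (yc D - yc A) * (xc X - xc A)))"
    and S: "A \<in> S" "D \<in> S" "B \<in> S" "C \<in> S" and ne: "A \<noteq> D"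
    and B: "(xc D - xc A) * (yc B - yc A) - (yc D - yc A) * (xc B - xc A) \<noteq> 0"
    and C: "(xc D - xc A) * (yc C - yc A) - (yc D - yc A) * (xc C - xc A) \<noteq> 0"
  shows "f B = f C"
proof -
  define m n where "m = xc D - xc A" and "n = yc D - yc A"
  define N where "N X = m * (yc X - yc A) - n * (xc X - xc A)" for X
  have nz: "m\<^sup>2 + n\<^sup>2 \<noteq> 0"
    using ne coords_eqI[of D A] by (auto simp: m_def n_def sum_power2_eq_zero_iff)
  obtain a b c where f: "\<And>X. X \<in> S \<Longrightarrow> f X * N X = a * xc X + b * yc X + c"
    using aff unfolding affine_on_def N_def m_def n_def by blast
  have "a * xc A + b * yc A + c = 0" using f[OF S(1)] by (simp add: N_def)
  moreover have "a * m + b * n = 0"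
    using f[OF S(1)] f[OF S(2)] by (simp add: N_def m_def n_def algebra_simps)
  ultimately have "(m\<^sup>2 + n\<^sup>2) * (a * xc X + b * yc X + c) = (b * m - a * n) * N X" for X
    unfolding N_def by algebra
  hence *: "(m\<^sup>2 + n\<^sup>2) * f X = b * m - a * n" if "X \<in> S" "N X \<noteq> 0" for X
    using f[OF that(1)] that(2) by (metis (no_types, lifting) mult.assoc mult_cancel_right)
  have "(m\<^sup>2 + n\<^sup>2) * f B = (m\<^sup>2 + n\<^sup>2) * f C"
    using *[OF S(3)] *[OF S(4)] B C unfolding N_def m_def n_def by simp
  with nz show ?thesis by (simp only: mult_cancel_left) blast
qed

text \<open>
  The conic and the circle make \<open>x\<^sup>2\<close> and \<open>y\<^sup>2\<close> agree with affine functions on the four points, unless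
  \<open>p = q\<close>. The product of the equations of the lines \<open>AD\<close> and \<open>BC\<close> is a third quadratic function that
  vanishes at the four points. Were its coefficient at \<open>x y\<close> not zero, all quadratic functions would
  be affine there; this is too much, as the products of the equation of \<open>AD\<close> with \<open>x\<close> and with \<open>y\<close>
  would force \<open>B = C\<close>. The coefficient is the expression in the conclusion, up to the factor \<open>p q\<close>.
\<close>

lemma concyclic_chords_antiparallel:
  assumes pq: "p \<noteq> 0" "q \<noteq> 0"
    and conic: "\<And>X. X \<in> {A, B, C, D} \<Longrightarrow> p * (xc X)\<^sup>2 + q * (yc X)\<^sup>2 = 1"
    and K: "is_circle K" "{A, B, C, D} \<subseteq> K"
    and distinct: "distinct [A, B, C, D]"
  shows "(q - p) * ((xc A + xc D) * (yc B + yc C) + (yc A + yc D) * (xc B + xc C)) = 0"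
proof (rule ccontr)
  assume "\<not> ?thesis"
  hence qp: "q - p \<noteq> 0"
    and k: "(xc A + xc D) * (yc B + yc C) + (yc A + yc D) * (xc B + xc C) \<noteq> 0" by auto
  let ?S = "{A, B, C, D}"
  obtain g h k where "K = {X. (xc X)\<^sup>2 + (yc X)\<^sup>2 = g * xc X + h * yc X + k}"
    using circle_equation[OF K(1)] .
  hence circ: "\<And>X. X \<in> ?S \<Longrightarrow> (xc X)\<^sup>2 + (yc X)\<^sup>2 = g * xc X + h * yc X + k"
    using K(2) by blast
  have zero: "affine_on ?S (\<lambda>_. 0)" by (rule affine_onI[of _ _ 0 0 0]) simp
  have xx: "affine_on ?S (\<lambda>X. (xc X)\<^sup>2)"
  proof (rule affine_on_solve[OF zero zero qp])
    fix X assume "X \<in> ?S"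
    show "(q - p) * (xc X)\<^sup>2 = 0 * 0 + 0 * 0 + (q * g) * xc X + (q * h) * yc X + (q * k - 1)"
      using conic[OF \<open>X \<in> ?S\<close>] circ[OF \<open>X \<in> ?S\<close>] by algebra
  qed
  have yy: "affine_on ?S (\<lambda>X. (yc X)\<^sup>2)"
  proof (rule affine_on_solve[OF xx zero pq(2)])
    fix X assume "X \<in> ?S"
    show "q * (yc X)\<^sup>2 = (- p) * (xc X)\<^sup>2 + 0 * 0 + 0 * xc X + 0 * yc X + 1"
      using conic[OF \<open>X \<in> ?S\<close>] by algebra
  qed
  \<comment> \<open>With \<open>\<kappa>\<close> the bilinear form of the conic, the chord through \<open>A\<close> and \<open>D\<close> is \<open>\<kappa>(X, A + D) = 1 + \<kappa>(A, D)\<close>; likewise for \<open>B\<close> and \<open>C\<close>.\<close>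
  define s1 s2 s0 where "s1 = p * (xc A + xc D)" and "s2 = q * (yc A + yc D)"
    and "s0 = 1 + p * xc A * xc D + q * yc A * yc D"
  define w1 w2 w0 where "w1 = p * (xc B + xc C)" and "w2 = q * (yc B + yc C)"
    and "w0 = 1 + p * xc B * xc C + q * yc B * yc C"
  have lines: "(s1 * xc X + s2 * yc X - s0) * (w1 * xc X + w2 * yc X - w0) = 0" if "X \<in> ?S" for X
  proof -
    have "s1 * xc X + s2 * yc X - s0 = 0" if "X \<in> {A, D}"
      using that conic[of A] conic[of D] unfolding s1_def s2_def s0_def
      by (auto simp: power2_eq_square algebra_simps)
    moreover have "w1 * xc X + w2 * yc X - w0 = 0" if "X \<in> {B, C}"
      using that conic[of B] conic[of C] unfolding w1_def w2_def w0_def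
      by (auto simp: power2_eq_square algebra_simps)
    ultimately show ?thesis using that by auto
  qed
  have "s1 * w2 + s2 * w1
      = p * q * ((xc A + xc D) * (yc B + yc C) + (yc A + yc D) * (xc B + xc C))"
    by (simp add: s1_def s2_def w1_def w2_def algebra_simps)
  hence sw: "s1 * w2 + s2 * w1 \<noteq> 0" using k pq by simp
  have xy: "affine_on ?S (\<lambda>X. xc X * yc X)"
  proof (rule affine_on_solve[OF xx yy sw])
    fix X assume "X \<in> ?S"
    show "(s1 * w2 + s2 * w1) * (xc X * yc X)
      = (- s1 * w1) * (xc X)\<^sup>2 + (- s2 * w2) * (yc X)\<^sup>2
        + (s1 * w0 + s0 * w1) * xc X + (s2 * w0 + s0 * w2) * yc X + (- s0 * w0)"
      using lines[OF \<open>X \<in> ?S\<close>] by algebra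
  qed
  have ne: "A \<noteq> D" "B \<noteq> A" "B \<noteq> D" "C \<noteq> A" "C \<noteq> D" "B \<noteq> C" using distinct by auto
  have B: "(xc D - xc A) * (yc B - yc A) - (yc D - yc A) * (xc B - xc A) \<noteq> 0"
   and C: "(xc D - xc A) * (yc C - yc A) - (yc D - yc A) * (xc C - xc A) \<noteq> 0"
    using three_points_on_circle_not_aligned[OF K(1)] K(2) ne by auto
  have "xc B = xc C"
  proof (rule affine_multiple_of_line[OF _ _ _ _ _ ne(1) B C])
    show "affine_on ?S (\<lambda>X. xc X * ((xc D - xc A) * (yc X - yc A) - (yc D - yc A) * (xc X - xc A)))"
      by (rule affine_on_solve[OF xx xy, of 1 _ "- (yc D - yc A)" "xc D - xc A"
            "(yc D - yc A) * xc A - (xc D - xc A) * yc A" 0 0])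
         (simp_all add: power2_eq_square algebra_simps)
  qed auto
  moreover have "yc B = yc C"
  proof (rule affine_multiple_of_line[OF _ _ _ _ _ ne(1) B C])
    show "affine_on ?S (\<lambda>X. yc X * ((xc D - xc A) * (yc X - yc A) - (yc D - yc A) * (xc X - xc A)))"
      by (rule affine_on_solve[OF yy xy, of 1 _ "xc D - xc A" "- (yc D - yc A)" 0
            "(yc D - yc A) * xc A - (xc D - xc A) * yc A" 0])
         (simp_all add: power2_eq_square algebra_simps)
  qed auto
  ultimately show False using ne(6) coords_eqI by blast
qed

section \<open>The circle through the meeting points\<close>

text \<open>
  The hypothesis puts the three points on a circle through \<open>E\<close>, or on the single point \<open>E\<close>
  when \<open>m = n = 0\<close>. Its equation and that of \<open>\<Sigma>\<close> differ by an affine function, which vanishes at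
  three points that are not collinear and hence is zero.
\<close>

lemma circle_through_determined:
  assumes \<Sigma>: "circle_through X Y Z \<Sigma>"
    and on: "\<And>W. W \<in> {X, Y, Z} \<Longrightarrow>
      (xc W - xc E)\<^sup>2 + (yc W - yc E)\<^sup>2 = m * (xc W - xc E) + n * (yc W - yc E)"
  shows "E \<in> \<Sigma>"
proof -
  have nc: "\<not> collinear {X, Y, Z}" and circ: "is_circle \<Sigma>" and sub: "{X, Y, Z} \<subseteq> \<Sigma>"
    using \<Sigma> by (auto simp: circle_through_def)
  obtain g h k where eq: "\<Sigma> = {X. (xc X)\<^sup>2 + (yc X)\<^sup>2 = g * xc X + h * yc X + k}"
    using circle_equation[OF circ] .
  define a b where "a = 2 * xc E + m - g" and "b = 2 * yc E + n - h"
  define e where "e = - (xc E)\<^sup>2 - (yc E)\<^sup>2 - m * xc E - n * yc E - k"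
  have van: "a * xc W + b * yc W + e = 0" if "W \<in> {X, Y, Z}" for W
  proof -
    have "(xc W)\<^sup>2 + (yc W)\<^sup>2 = g * xc W + h * yc W + k" using that sub eq by blast
    with on[OF that] show ?thesis
      unfolding a_def b_def e_def by (simp add: power2_eq_square algebra_simps)
  qed
  have "a = 0 \<and> b = 0"
  proof (rule ccontr)
    assume "\<not> (a = 0 \<and> b = 0)"
    hence ne: "- b \<noteq> 0 \<or> a \<noteq> 0" by auto
    have "\<exists>c. V - W = c *\<^sub>R (a *\<^sub>R v - b *\<^sub>R u)" if "V \<in> {X, Y, Z}" "W \<in> {X, Y, Z}" for V W
    proof -
      have "(xc V - xc W) * a = (yc V - yc W) * (- b)"
        using van[OF that(1)] van[OF that(2)] by (simp add: algebra_simps)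
      then obtain c where "xc V - xc W = c * (- b)" "yc V - yc W = c * a"
        using ne by (rule parallel_imp_multiple)
      hence "V - W = c *\<^sub>R (a *\<^sub>R v - b *\<^sub>R u)"
        by (intro frame_eqI) (simp_all add: xc_def yc_def inner_diff_left)
      then show ?thesis ..
    qed
    hence "collinear {X, Y, Z}" unfolding collinear_def by blast
    with nc show False ..
  qed
  hence ab: "a = 0" "b = 0" by simp_all
  hence "e = 0" using van[of X] by simp
  moreover have "g = 2 * xc E + m" "h = 2 * yc E + n" using ab by (simp_all add: a_def b_def)
  ultimately have "(xc E)\<^sup>2 + (yc E)\<^sup>2 = g * xc E + h * yc E + k"
    by (simp add: e_def power2_eq_square algebra_simps)
  then show ?thesis unfolding eq by simp
qed

text \<open>
  The conclusion is the equation of a circle through \<open>- D\<close> in the point \<open>X\<close>; it is written out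
  so as to be visibly symmetric in \<open>A\<close>, \<open>B\<close>, \<open>C\<close>, so that the corresponding points for \<open>B\<close> and \<open>C\<close>
  satisfy the same equation.
\<close>

lemma meet_point_on_common_circle:
  assumes pq: "p \<noteq> 0" "q \<noteq> 0"
    and A: "p * (xc A)\<^sup>2 + q * (yc A)\<^sup>2 = 1" and D: "p * (xc D)\<^sup>2 + q * (yc D)\<^sup>2 = 1"
    and P: "p * (xc P)\<^sup>2 + q * (yc P)\<^sup>2 = 1"
    and anti: "(q - p) * ((xc A + xc D) * (yc B + yc C) + (yc A + yc D) * (xc B + xc C)) = 0"
    and meet: "meet_at (half_turn M A) P A (half_turn M D) X"
  shows "2 * (1 - (p * xc D * xc P + q * yc D * yc P)) * ((xc X + xc D)\<^sup>2 + (yc X + yc D)\<^sup>2)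
    = (xc D * yc P - yc D * xc P)
       * ((2 * (p + q) * xc D + (q - p) * (xc A + xc B + xc C - xc D)) * (yc X + yc D)
        - (2 * (p + q) * yc D - (q - p) * (yc A + yc B + yc C - yc D)) * (xc X + xc D))"
proof -
  obtain t where X: "xc X = - xc D + t * (xc A + xc D)" "yc X = - yc D + t * (yc A + yc D)"
    and on: "(xc X + xc A) * (yc P + yc A) = (yc X + yc A) * (xc P + xc A)"
    and npar: "(xc A + xc D) * (yc P + yc A) - (yc A + yc D) * (xc P + xc A) \<noteq> 0"
    by (rule meet_at_coords[OF meet], unfold coords_half_turn diff_minus_eq_add right_minus_eq) blast
  have AD: "A \<noteq> half_turn M D" using meet by (simp add: meet_at_def)
  define c where "c = 1 + (p * xc A * xc D + q * yc A * yc D)"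
  define d where "d = 1 - (p * xc D * xc P + q * yc D * yc P)"
  define w where "w = xc D * yc P - yc D * xc P"
  define r where "r = (xc A + xc D)\<^sup>2 + (yc A + yc D)\<^sup>2"
  define L1 where "L1 = 2 * (p + q) * xc D + (q - p) * (xc A + xc B + xc C - xc D)"
  define L2 where "L2 = 2 * (p + q) * yc D - (q - p) * (yc A + yc B + yc C - yc D)"
  define l where "l = L1 * (yc A + yc D) - L2 * (xc A + xc D)"
  have c: "c \<noteq> 0"
  proof
    assume "c = 0"
    hence "xc A = - xc D \<and> yc A = - yc D"
      using conic_polar_eq_one[of p "xc A" q "yc A" "- xc D" "- yc D"] A D pq by (simp add: c_def)
    with AD coords_eqI[of A "half_turn M D"] show False by simp
  qed
  have "t * ((xc A + xc D) * (yc P + yc A) - (yc A + yc D) * (xc P + xc A))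
      = (xc D - xc A) * (yc P + yc A) - (yc D - yc A) * (xc P + xc A)"
    using on unfolding X by (simp add: algebra_simps)
  with chord_meeting_ratio[OF A D P]
  have "(t * c * d) * ((xc A + xc D) * (yc P + yc A) - (yc A + yc D) * (xc P + xc A))
      = (p * q * w * (xc D * yc A - yc D * xc A))
        * ((xc A + xc D) * (yc P + yc A) - (yc A + yc D) * (xc P + xc A))"
    unfolding c_def d_def w_def by algebra
  hence "t * c * d = p * q * w * (xc D * yc A - yc D * xc A)" using npar by simp
  moreover have "2 * p * q * (xc D * yc A - yc D * xc A) * r = c * l"
    using chord_length_identity[OF A D anti] by (simp add: r_def c_def l_def L1_def L2_def)
  ultimately have "c * (2 * d * t * r) = c * (w * l)" by algebra
  hence "2 * d * t * r = w * l" using c by simp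
  hence *: "2 * d * (t\<^sup>2 * r) = w * (t * l)" by algebra
  have XD: "xc X + xc D = t * (xc A + xc D)" "yc X + yc D = t * (yc A + yc D)"
    by (simp_all add: X)
  have "(xc X + xc D)\<^sup>2 + (yc X + yc D)\<^sup>2 = t\<^sup>2 * r"
    unfolding XD r_def power_mult_distrib by (rule distrib_left[symmetric])
  moreover have "L1 * (yc X + yc D) - L2 * (xc X + xc D) = t * l"
    unfolding XD l_def by (simp add: algebra_simps)
  ultimately show ?thesis using * by (simp add: d_def w_def L1_def L2_def)
qed

text \<open>
  The point \<open>P\<close> is off the circle and hence distinct from \<open>D\<close>, so the common equation of the three
  meeting points does not degenerate to \<open>0 = 0\<close>.
\<close>

lemma antipode_on_circle:
  assumes pq: "p \<noteq> 0" "q \<noteq> 0"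
    and conic: "\<And>X. X \<in> {A, B, C, D, P} \<Longrightarrow> p * (xc X)\<^sup>2 + q * (yc X)\<^sup>2 = 1"
    and K: "is_circle K" "{A, B, C, D} \<subseteq> K" "P \<notin> K"
    and distinct: "distinct [A, B, C, D]"
    and meets: "meet_at (half_turn M A) P A (half_turn M D) X"
      "meet_at (half_turn M B) P B (half_turn M D) Y"
      "meet_at (half_turn M C) P C (half_turn M D) Z"
    and \<Sigma>: "circle_through X Y Z \<Sigma>"
  shows "half_turn M D \<in> \<Sigma>"
proof -
  have antiA: "(q - p) * ((xc A + xc D) * (yc B + yc C) + (yc A + yc D) * (xc B + xc C)) = 0"
    by (rule concyclic_chords_antiparallel[OF pq _ K(1)]) (use conic K distinct in auto)
  have antiB: "(q - p) * ((xc B + xc D) * (yc A + yc C) + (yc B + yc D) * (xc A + xc C)) = 0"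
    by (rule concyclic_chords_antiparallel[OF pq _ K(1)]) (use conic K distinct in auto)
  have antiC: "(q - p) * ((xc C + xc D) * (yc A + yc B) + (yc C + yc D) * (xc A + xc B)) = 0"
    by (rule concyclic_chords_antiparallel[OF pq _ K(1)]) (use conic K distinct in auto)
  define d where "d = 1 - (p * xc D * xc P + q * yc D * yc P)"
  define w where "w = xc D * yc P - yc D * xc P"
  define L1 where "L1 = 2 * (p + q) * xc D + (q - p) * (xc A + xc B + xc C - xc D)"
  define L2 where "L2 = 2 * (p + q) * yc D - (q - p) * (yc A + yc B + yc C - yc D)"
  have d: "d \<noteq> 0"
  proof
    assume "d = 0"
    hence "xc D = xc P \<and> yc D = yc P"
      using conic_polar_eq_one[of p "xc D" q "yc D" "xc P" "yc P"] conic[of D] conic[of P] pq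
      by (simp add: d_def)
    hence "D = P" using coords_eqI by blast
    with K show False by auto
  qed
  have on: "2 * d * ((xc W + xc D)\<^sup>2 + (yc W + yc D)\<^sup>2)
      = w * (L1 * (yc W + yc D) - L2 * (xc W + xc D))" if "W \<in> {X, Y, Z}" for W
  proof -
    have "2 * d * ((xc X + xc D)\<^sup>2 + (yc X + yc D)\<^sup>2)
        = w * (L1 * (yc X + yc D) - L2 * (xc X + xc D))"
      using meet_point_on_common_circle[OF pq _ _ _ antiA meets(1)] conic
      by (simp add: d_def w_def L1_def L2_def)
    moreover have "2 * d * ((xc Y + xc D)\<^sup>2 + (yc Y + yc D)\<^sup>2)
        = w * (L1 * (yc Y + yc D) - L2 * (xc Y + xc D))"
      using meet_point_on_common_circle[OF pq _ _ _ antiB meets(2)] conic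
      by (simp add: d_def w_def L1_def L2_def add.commute add.left_commute)
    moreover have "2 * d * ((xc Z + xc D)\<^sup>2 + (yc Z + yc D)\<^sup>2)
        = w * (L1 * (yc Z + yc D) - L2 * (xc Z + xc D))"
      using meet_point_on_common_circle[OF pq _ _ _ antiC meets(3)] conic
      by (simp add: d_def w_def L1_def L2_def add.commute add.left_commute)
    ultimately show ?thesis using that by auto
  qed
  show ?thesis
  proof (rule circle_through_determined[OF \<Sigma>])
    fix W assume "W \<in> {X, Y, Z}"
    have "(xc W + xc D)\<^sup>2 + (yc W + yc D)\<^sup>2
      = w * (L1 * (yc W + yc D) - L2 * (xc W + xc D)) / (2 * d)"
      using on[OF \<open>W \<in> {X, Y, Z}\<close>] d by (simp add: eq_divide_eq mult.commute)
    then show "(xc W - xc (half_turn M D))\<^sup>2 + (yc W - yc (half_turn M D))\<^sup>2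
      = (- w * L2 / (2 * d)) * (xc W - xc (half_turn M D))
        + (w * L1 / (2 * d)) * (yc W - yc (half_turn M D))"
      by (simp add: diff_divide_distrib add_divide_distrib algebra_simps)
  qed
qed

end

section \<open>The four circles\<close>

lemma central_conic_equation:
  assumes "central_conic K M"
  obtains u v p q where "orthonormal_frame u v" "p \<noteq> 0" "q \<noteq> 0"
    "K = {X. p * ((X - M) \<bullet> u)\<^sup>2 + q * ((X - M) \<bullet> v)\<^sup>2 = 1}"
  using assms unfolding central_conic_def
proof
  assume "is_ellipse K M"
  then obtain u v a b where "orthonormal_frame u v" "a > 0" "b > 0"
    "K = {X. ((X - M) \<bullet> u)\<^sup>2 / a\<^sup>2 + ((X - M) \<bullet> v)\<^sup>2 / b\<^sup>2 = 1}"
    unfolding is_ellipse_def orthonormal_frame_def by blast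
  then show thesis by (intro that[of u v "1 / a\<^sup>2" "1 / b\<^sup>2"]) simp_all
next
  assume "is_hyperbola K M"
  then obtain u v a b where "orthonormal_frame u v" "a > 0" "b > 0"
    "K = {X. ((X - M) \<bullet> u)\<^sup>2 / a\<^sup>2 - ((X - M) \<bullet> v)\<^sup>2 / b\<^sup>2 = 1}"
    unfolding is_hyperbola_def orthonormal_frame_def by blast
  then show thesis by (intro that[of u v "1 / a\<^sup>2" "- 1 / b\<^sup>2"]) simp_all
qed

theorem theorem5:
  fixes A B C D D\<^sub>4 M A\<^sub>1 B\<^sub>2 C\<^sub>3 P :: point
    and A\<^sub>4 B\<^sub>4 C\<^sub>4 B\<^sub>1 C\<^sub>1 D\<^sub>1 A\<^sub>2 C\<^sub>2 D\<^sub>2 A\<^sub>3 B\<^sub>3 D\<^sub>3 :: point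
    and \<Gamma> \<C> \<Sigma>\<^sub>1 \<Sigma>\<^sub>2 \<Sigma>\<^sub>3 \<Sigma>\<^sub>4 :: "point set"
  assumes "circle_through A B C \<Gamma>"
    and "D\<^sub>4 \<notin> {A, B, C}" and "\<not> is_orthocentre A B C D\<^sub>4"
    and "central_conic \<C> M" and "{A, B, C, D\<^sub>4} \<subseteq> \<C>"
    and "D = half_turn M D\<^sub>4" and "D \<in> \<Gamma>" and "D \<notin> {A, B, C}"
    and "A\<^sub>1 = half_turn M A" and "B\<^sub>2 = half_turn M B" and "C\<^sub>3 = half_turn M C"
    and "P \<in> \<C>" and "P \<notin> \<Gamma>"
    and "P \<notin> line_through B C" and "P \<notin> line_through C A" and "P \<notin> line_through A B"
    and "P \<notin> {A\<^sub>1, B\<^sub>2, C\<^sub>3, D\<^sub>4}"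
    and "meet_at A\<^sub>1 P A D\<^sub>4 A\<^sub>4" and "meet_at B\<^sub>2 P B D\<^sub>4 B\<^sub>4" and "meet_at C\<^sub>3 P C D\<^sub>4 C\<^sub>4"
    and "meet_at B\<^sub>2 P B A\<^sub>1 B\<^sub>1" and "meet_at C\<^sub>3 P C A\<^sub>1 C\<^sub>1" and "meet_at D\<^sub>4 P D A\<^sub>1 D\<^sub>1"
    and "meet_at A\<^sub>1 P A B\<^sub>2 A\<^sub>2" and "meet_at C\<^sub>3 P C B\<^sub>2 C\<^sub>2" and "meet_at D\<^sub>4 P D B\<^sub>2 D\<^sub>2"
    and "meet_at A\<^sub>1 P A C\<^sub>3 A\<^sub>3" and "meet_at B\<^sub>2 P B C\<^sub>3 B\<^sub>3" and "meet_at D\<^sub>4 P D C\<^sub>3 D\<^sub>3"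
    and "circle_through A\<^sub>4 B\<^sub>4 C\<^sub>4 \<Sigma>\<^sub>4" and "circle_through B\<^sub>1 C\<^sub>1 D\<^sub>1 \<Sigma>\<^sub>1"
    and "circle_through A\<^sub>2 C\<^sub>2 D\<^sub>2 \<Sigma>\<^sub>2" and "circle_through A\<^sub>3 B\<^sub>3 D\<^sub>3 \<Sigma>\<^sub>3"
  shows "D\<^sub>4 \<in> \<Sigma>\<^sub>4 \<and> A\<^sub>1 \<in> \<Sigma>\<^sub>1 \<and> B\<^sub>2 \<in> \<Sigma>\<^sub>2 \<and> C\<^sub>3 \<in> \<Sigma>\<^sub>3"
proof -
  obtain u v p q where frame: "orthonormal_frame u v" and pq: "p \<noteq> 0" "q \<noteq> 0"
    and \<C>: "\<C> = {X. p * ((X - M) \<bullet> u)\<^sup>2 + q * ((X - M) \<bullet> v)\<^sup>2 = 1}"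
    using central_conic_equation[OF assms(4)] .
  interpret orthonormal_frame u v M by (rule frame)
  have \<Gamma>: "is_circle \<Gamma>" "{A, B, C} \<subseteq> \<Gamma>" and nc: "\<not> collinear {A, B, C}"
    using assms(1) by (auto simp: circle_through_def)
  have "A \<noteq> B" "B \<noteq> C" "C \<noteq> A"
    using nc by (auto simp: collinear_2 insert_absorb2 insert_commute)
  hence distinct: "distinct [A, B, C, D]" using assms(8) by auto
  have D\<^sub>4: "D\<^sub>4 = half_turn M D" using assms(6) by (simp add: half_turn_def)
  have eq: "p * (xc X)\<^sup>2 + q * (yc X)\<^sup>2 = 1" if "X \<in> \<C>" for X
    using that by (simp add: \<C> xc_def yc_def)
  have "p * (xc D)\<^sup>2 + q * (yc D)\<^sup>2 = 1" using eq[of D\<^sub>4] assms(5) by (simp add: D\<^sub>4)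
  hence conic: "p * (xc X)\<^sup>2 + q * (yc X)\<^sup>2 = 1" if "X \<in> {A, B, C, D, P}" for X
    using that eq assms(5,12) by auto
  have ABCD: "{A, B, C, D} \<subseteq> \<Gamma>" using \<Gamma> assms(7) by simp
  \<comment> \<open>The four circles belong to \<open>D\<close>, \<open>A\<close>, \<open>B\<close>, \<open>C\<close> in turn.\<close>
  note meets = assms(18-29)[unfolded assms(9-11) D\<^sub>4]
  have "D\<^sub>4 \<in> \<Sigma>\<^sub>4" unfolding D\<^sub>4
    by (rule antipode_on_circle[OF pq _ \<Gamma>(1) _ assms(13) _ meets(1-3) assms(30)])
      (use conic ABCD distinct in auto)
  moreover have "A\<^sub>1 \<in> \<Sigma>\<^sub>1" unfolding assms(9)
    by (rule antipode_on_circle[OF pq _ \<Gamma>(1) _ assms(13) _ meets(4-6) assms(31)])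
      (use conic ABCD distinct in auto)
  moreover have "B\<^sub>2 \<in> \<Sigma>\<^sub>2" unfolding assms(10)
    by (rule antipode_on_circle[OF pq _ \<Gamma>(1) _ assms(13) _ meets(7-9) assms(32)])
      (use conic ABCD distinct in auto)
  moreover have "C\<^sub>3 \<in> \<Sigma>\<^sub>3" unfolding assms(11)
    by (rule antipode_on_circle[OF pq _ \<Gamma>(1) _ assms(13) _ meets(10-12) assms(33)])
      (use conic ABCD distinct in auto)
  ultimately show ?thesis by blast
qed

end
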